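(* Let $h\in\mathcal S$ be an abstract device state, let $s,s'$ be FTL states, and let $\mathit{ops}$ be any finite sequence (trace) of operations. If $\mathtt{ftl\_invariant}(s)$ holds, $\mathcal R(h,s)$ holds, and $\mathtt{exec}(s,\mathit{ops})=\mathtt{Some}\;s'$, then $\mathcal R(\mathtt{abs\_exec}(h,\mathit{ops}),s')$ and $\mathtt{ftl\_invariant}(s')$ hold.
   Context: **Geometry and types.** Fixed natural-number constants $\mathtt{addr\_space}$, $\mathtt{pages\_per\_block}$ (with $\mathtt{pages\_per\_block}>0$), $\mathtt{total\_blocks}$. All index types ($\mathtt{Addr}$, $\mathtt{Page}$, $\mathtt{Block}$, $\mathtt{TenantId}$, $\mathtt{NamespaceId}$, $\mathtt{KeyId}$) are natural numbers; $\mathtt{Data}$ and $\mathtt{Tag}$ are sets; $T?$ means "optional $T$" ($\mathtt{None}$ or $\mathtt{Some}\;x$). $\mathtt{PhysAddr}=\mathtt{Block}\times\mathtt{Page}$. A logical page is a pair $(a,p)$ (address, page offset); a physical page is a pair $(b,q)$. A logical page is in bounds if $a<\mathtt{addr\_space}$ and $p<\mathtt{pages\_per\_block}$; a block is in bounds if $b<\mathtt{total\_blocks}$; a physical page is in bounds if also $q<\mathtt{pages\_per\_block}$. The pages of block $b$ are the $(b,q)$ with $q<\mathtt{pages\_per\_block}$. In the invariant, "page" means an in-bounds physical page. **State.** An $\mathtt{FTLState}$ $s$ is a record with fields: $\mathtt{l2p\_map}:\mathtt{Addr}\times\mathtt{Page}\to\mathtt{PhysAddr}?$; $\mathtt{page\_state}:\mathtt{Block}\times\mathtt{Page}\to\{\mathtt{PS\_Empty},\mathtt{PS\_Invalid}\}\cup\{\mathtt{PS\_Valid}(d)\}$;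 $\mathtt{page\_role}:\mathtt{Block}\times\mathtt{Page}\to\{\mathtt{RData},\mathtt{RMeta}\}?$; $\mathtt{page\_meta}:\mathtt{Block}\times\mathtt{Page}\to\mathtt{PageMeta}$, where a $\mathtt{PageMeta}$ consists of an optional owner tenant, optional owner namespace, optional integrity tag, and optional reverse mapping (a logical page); $\mathtt{addr\_tenant},\mathtt{addr\_namespace}$ (from $\mathtt{Addr}$) and $\mathtt{block\_tenant},\mathtt{block\_namespace}$ (from $\mathtt{Block}$) to optional tenant ids, resp. namespace ids; $\mathtt{region\_table}:\mathbb N\to\mathtt{RegionMeta}?$ (a region has a tenant, a namespace, and an address range); $\mathtt{free\_block\_list}$, a list of blocks; $\mathtt{free\_block}:\mathtt{Block}\to\mathtt{bool}$; $\mathtt{wear\_count}:\mathtt{Block}\to\mathbb N$; $\mathtt{open\_block}:\mathtt{TenantId}\times\mathtt{NamespaceId}\to\mathtt{Block}?$; $\mathtt{write\_ptr}:\mathtt{TenantId}\times\mathtt{NamespaceId}\to\mathtt{Page}$; $\mathtt{block\_open}:\mathtt{Block}\to\mathtt{bool}$; $\mathtt{key\_table}:\mathtt{KeyId}\to\mathtt{KeyMeta}?$. A physical page is erased / stale / live if its state is $\mathtt{PS\_Empty}$ / $\mathtt{PS\_Invalid}$ / $\mathtt{PS\_Valid}(d)$ for some $d$. It is a user-data page if its role is $\mathtt{RData}$, a metadata page if its role is $\mathtt{RMeta}$. It carries no metadata if all four components of its $\mathtt{page\_meta}$ are $\mathtt{None}$. A physical page is mapped if it is the $\mathtt{l2p\_map}$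 value of some logical page; a block is in use if some page of it is mapped. An address is labelled if it has both a tenant and a namespace. A block $b$ is open for owner $(t,n)$ if $\mathtt{open\_block}(t,n)=\mathtt{Some}\;b$; its write frontier is then $\mathtt{write\_ptr}(t,n)$. "The free list" is $\mathtt{free\_block\_list}$. **Invariant.** $\mathtt{ftl\_invariant}(s)$ is the conjunction of: $\mathtt{WF}_0$: $\mathtt{pages\_per\_block}>0$; $\mathtt{WF}_1$: $\mathtt{page\_state}$ is defined at every in-bounds page (automatic); and Inv0: every live page is the target of some logical page in the L2P map. Inv1: every L2P entry maps an in-bounds logical page to an in-bounds physical page. Inv2: the L2P map is injective: no two distinct logical pages map to the same physical page. Inv3: if a logical page maps to a live physical page, that page's reverse mapping names that logical page. Inv4: if a live page's reverse mapping names a logical page, the L2P map sends that logical page to this page. Inv5: no block that holds a mapped page is in the free list. Inv6: every page of a block in the free list is erased and carries no metadata. Inv7: a live page mapped from address $a$ records (in $\mathtt{page\_meta}$) $a$'s owning tenant and namespace. Inv8: every block in the free list is $<\mathtt{total\_blocks}$. Inv9: every live page carries an integrity tag. Inv10: every in-bounds block is in the free list, or marked open ($\mathtt{block\_open}$), or in use, or holds a stale page. Inv11: no block appears twice in the free list. Inv12: an in-bounds block that holds a metadata page is in use or holds a stale page. Inv13: every live page is a user-data page. Inv14: every user-data page is live. Inv15: every metadata page is non-erased. Inv16: every erased page has role $\mathtt{None}$. Inv17: every block with $\mathtt{free\_block}(b)=\mathtt{true}$ has no owning tenant and no owning namespace. Inv18: a block that holds a page mapped from address $a$ has $\mathtt{block\_tenant}$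 and $\mathtt{block\_namespace}$ equal to $\mathtt{addr\_tenant}(a)$ and $\mathtt{addr\_namespace}(a)$. Inv19: every defined region covers only addresses within $\mathtt{addr\_space}$. Inv20: if $b$ is open for $(t,n)$ then $b$ is in bounds, not free, $\mathtt{block\_open}(b)=\mathtt{true}$, $\mathtt{write\_ptr}(t,n)\le\mathtt{pages\_per\_block}$, $b$ is open for no other owner, and either $b$'s tenant and namespace are $t$ and $n$ or $b$ has neither. Inv21: every page of an open block at offset $\ge$ its write frontier is erased and carries no metadata. Inv22: the L2P map points only at live pages. Inv23: every block with $\mathtt{block\_open}(b)=\mathtt{true}$ is open for some owner. Inv24: $\mathtt{free\_block}(b)=\mathtt{true}$ iff $b$ is in the free list. Inv25: every page of an open block at offset below its write frontier is not erased. Inv26: every mapped address (an $a$ with $\mathtt{l2p\_map}(a,p)\ne\mathtt{None}$ for some $p$) has an owning tenant and namespace. **Operations.** There are six operations. $\mathtt{step}(s,\sigma)$ is $\mathtt{Some}\;s'$ when the operation applies and $\mathtt{None}$ when it is rejected. Only the listed changes are made; no operation changes the address labels, the region table or the key table. Auxiliary steps: *Invalidate the physical page of $(a,p)$*: if $\mathtt{l2p\_map}(a,p)=\mathtt{Some}(b,q)$, set $\mathtt{page\_state}(b,q):=\mathtt{PS\_Invalid}$, $\mathtt{page\_role}(b,q):=\mathtt{None}$, $\mathtt{l2p\_map}(a,p):=\mathtt{None}$; otherwise do nothing. *Place $(a,p)$ with data $d$ and tag $g$*, where $a$ is labelled $(t,n)$: the destination is obtained from the owner's write frontier. If $\mathtt{open\_block}(t,n)=\mathtt{Some}\;b$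 and $\mathtt{write\_ptr}(t,n)<\mathtt{pages\_per\_block}$, the destination is $(b,\mathtt{write\_ptr}(t,n))$. Otherwise, remove the head $b$ of the free list (fail if the list is empty), set $\mathtt{free\_block}(b):=\mathtt{false}$, set $\mathtt{block\_open}:=\mathtt{false}$ at the owner's previously open block (if any), set $\mathtt{open\_block}(t,n):=\mathtt{Some}\;b$, $\mathtt{block\_open}(b):=\mathtt{true}$, $\mathtt{write\_ptr}(t,n):=0$, and the destination is $(b,0)$. With destination $(b,q)$: set $\mathtt{page\_state}(b,q):=\mathtt{PS\_Valid}(d)$, $\mathtt{page\_role}(b,q):=\mathtt{RData}$, $\mathtt{page\_meta}(b,q):=$ (owner $t$, namespace $n$, tag $g$, reverse mapping $(a,p)$), $\mathtt{block\_tenant}(b):=t$, $\mathtt{block\_namespace}(b):=n$, $\mathtt{write\_ptr}(t,n):=q+1$, $\mathtt{l2p\_map}(a,p):=\mathtt{Some}(b,q)$. *Erase $b$*: every page of $b$ becomes $\mathtt{PS\_Empty}$, role $\mathtt{None}$, no metadata; $\mathtt{block\_tenant}(b),\mathtt{block\_namespace}(b):=\mathtt{None}$; $\mathtt{wear\_count}(b)$ is incremented; $b$ is pushed on the front of the free list and $\mathtt{free\_block}(b):=\mathtt{true}$. The six operations: $\mathtt{COpRead}(a,p)$: identity on the state. $\mathtt{COpWrite}(a,p,d)$: rejected unless $a<\mathtt{addr\_space}$, $p<\mathtt{pages\_per\_block}$, $a$ is labelled, and a destination page is available; otherwise invalidate the physical page of $(a,p)$ (if any), then place $(a,p)$ with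 data $d$ and an integrity tag supplied by the FTL (a fixed function of the data). $\mathtt{COpInvalidate}(a,p)$: invalidate the physical page of $(a,p)$; no effect if unmapped. $\mathtt{COpSetTag}(a,p,\mathit{tag})$: if $(a,p)$ maps to a live page, set that page's integrity tag to $\mathit{tag}$; otherwise no effect. $\mathtt{COpGC}$: a fixed victim-selection function of the state picks a reclaimable block $v$ (in bounds, not in the free list, not marked open); rejected if there is none. For each live page of $v$ in turn, with data $d$ and reverse mapping $(a,p)$: invalidate the physical page of $(a,p)$, then place $(a,p)$ with data $d$ and the old page's tag; the whole operation is rejected if any relocation fails. Then erase $v$. $\mathtt{COpWearLevel}$: same as $\mathtt{COpGC}$ with a different victim-selection function. $\mathtt{exec}(s,\mathit{ops})$ folds $\mathtt{step}$ over $\mathit{ops}$ starting from $s$, returning $\mathtt{None}$ if any step is rejected. **Abstract device and refinement relation.** $\mathcal S$ is the set of partial maps $h:(\mathtt{Addr}\times\mathtt{Page})\rightharpoonup\mathtt{Data}$. $\mathtt{abs\_step}(h,\sigma)$: $\mathtt{COpWrite}(a,p,d)$ updates $h(a,p)$ to $d$; $\mathtt{COpInvalidate}(a,p)$ makes $h(a,p)$ undefined; reads, tag writes, garbage collection and wear leveling leave $h$ unchanged. $\mathtt{abs\_exec}(h,\mathit{ops})$ folds $\mathtt{abs\_step}$ over $\mathit{ops}$ starting from $h$. $\mathcal R(h,s)$ holds iff for all $a,p,d$, if $h(a,p)$ is defined and equals $d$, then there exist $b,q$ with $\mathtt{l2p\_map}(s,a,p)=\mathtt{Some}\;(b,q)$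 and $\mathtt{page\_state}(s,b,q)=\mathtt{PS\_Valid}(d)$. *)

theory Defs
  imports Main
begin

type_synonym lpage = "nat \<times> nat"   \<comment> \<open>address, page offset\<close>
type_synonym ppage = "nat \<times> nat"   \<comment> \<open>block, page offset\<close>
type_synonym owner = "nat \<times> nat"   \<comment> \<open>tenant, namespace\<close>

datatype 'd pstate = PS_Empty | PS_Invalid | PS_Valid 'd

datatype prole = RData | RMeta

record 'g pmeta =
  pm_tenant :: "nat option"
  pm_namespace :: "nat option"
  pm_tag :: "'g option"
  pm_rmap :: "lpage option"

text \<open>The address range of a region is the half-open interval from \<open>rg_start\<close> to \<open>rg_end\<close>.\<close>

record region_meta =
  rg_tenant :: nat
  rg_namespace :: nat
  rg_start :: nat
  rg_end :: nat

text \<open>\<open>'d\<close>, \<open>'g\<close> and \<open>'k\<close> are the types of data, integrity tags and key records.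
  Key records are never inspected.\<close>

record ('d, 'g, 'k) ftl_state =
  l2p_map :: "lpage \<Rightarrow> ppage option"
  page_state :: "ppage \<Rightarrow> 'd pstate"
  page_role :: "ppage \<Rightarrow> prole option"
  page_meta :: "ppage \<Rightarrow> 'g pmeta"
  addr_tenant :: "nat \<Rightarrow> nat option"
  addr_namespace :: "nat \<Rightarrow> nat option"
  block_tenant :: "nat \<Rightarrow> nat option"
  block_namespace :: "nat \<Rightarrow> nat option"
  region_table :: "nat \<Rightarrow> region_meta option"
  free_block_list :: "nat list"
  free_block :: "nat \<Rightarrow> bool"
  wear_count :: "nat \<Rightarrow> nat"
  open_block :: "owner \<Rightarrow> nat option"
  write_ptr :: "owner \<Rightarrow> nat"
  block_open :: "nat \<Rightarrow> bool"
  key_table :: "nat \<Rightarrow> 'k option"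

text \<open>The fixed parameters of a device: its geometry, the tag the FTL attaches to
  written data, and the two victim-selection functions.\<close>

record ('d, 'g, 'k) ftl_config =
  addr_space :: nat
  pages_per_block :: nat
  total_blocks :: nat
  tag_of :: "'d \<Rightarrow> 'g"
  gc_victim :: "('d, 'g, 'k) ftl_state \<Rightarrow> nat option"
  wl_victim :: "('d, 'g, 'k) ftl_state \<Rightarrow> nat option"

definition reclaimable :: "('d, 'g, 'k) ftl_config \<Rightarrow> ('d, 'g, 'k) ftl_state \<Rightarrow> nat \<Rightarrow> bool" where
  "reclaimable C s v \<longleftrightarrow>
     v < total_blocks C \<and> v \<notin> set (free_block_list s) \<and> \<not> block_open s v"

definition victim_selection ::
  "('d, 'g, 'k) ftl_config \<Rightarrow> (('d, 'g, 'k) ftl_state \<Rightarrow> nat option) \<Rightarrow> bool" where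
  "victim_selection C sel \<longleftrightarrow>
     (\<forall>s. case sel s of Some v \<Rightarrow> reclaimable C s v | None \<Rightarrow> \<not> (\<exists>v. reclaimable C s v))"

definition valid_config :: "('d, 'g, 'k) ftl_config \<Rightarrow> bool" where
  "valid_config C \<longleftrightarrow>
     pages_per_block C > 0 \<and> victim_selection C (gc_victim C) \<and> victim_selection C (wl_victim C)"


section \<open>Invariant\<close>

definition lpage_ok :: "('d, 'g, 'k) ftl_config \<Rightarrow> lpage \<Rightarrow> bool" where
  "lpage_ok C x \<longleftrightarrow> fst x < addr_space C \<and> snd x < pages_per_block C"

definition ppage_ok :: "('d, 'g, 'k) ftl_config \<Rightarrow> ppage \<Rightarrow> bool" where
  "ppage_ok C y \<longleftrightarrow> fst y < total_blocks C \<and> snd y < pages_per_block C"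

definition live :: "('d, 'g, 'k) ftl_state \<Rightarrow> ppage \<Rightarrow> bool" where
  "live s y \<longleftrightarrow> (\<exists>d. page_state s y = PS_Valid d)"

definition stale :: "('d, 'g, 'k) ftl_state \<Rightarrow> ppage \<Rightarrow> bool" where
  "stale s y \<longleftrightarrow> page_state s y = PS_Invalid"

definition erased :: "('d, 'g, 'k) ftl_state \<Rightarrow> ppage \<Rightarrow> bool" where
  "erased s y \<longleftrightarrow> page_state s y = PS_Empty"

definition no_meta :: "('d, 'g, 'k) ftl_state \<Rightarrow> ppage \<Rightarrow> bool" where
  "no_meta s y \<longleftrightarrow>
     pm_tenant (page_meta s y) = None \<and> pm_namespace (page_meta s y) = None \<and>
     pm_tag (page_meta s y) = None \<and> pm_rmap (page_meta s y) = None"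

definition mapped :: "('d, 'g, 'k) ftl_state \<Rightarrow> ppage \<Rightarrow> bool" where
  "mapped s y \<longleftrightarrow> (\<exists>x. l2p_map s x = Some y)"

definition in_use :: "('d, 'g, 'k) ftl_config \<Rightarrow> ('d, 'g, 'k) ftl_state \<Rightarrow> nat \<Rightarrow> bool" where
  "in_use C s b \<longleftrightarrow> (\<exists>q < pages_per_block C. mapped s (b, q))"

definition holds_stale :: "('d, 'g, 'k) ftl_config \<Rightarrow> ('d, 'g, 'k) ftl_state \<Rightarrow> nat \<Rightarrow> bool" where
  "holds_stale C s b \<longleftrightarrow> (\<exists>q < pages_per_block C. stale s (b, q))"

definition labelled :: "('d, 'g, 'k) ftl_state \<Rightarrow> nat \<Rightarrow> bool" where
  "labelled s a \<longleftrightarrow> addr_tenant s a \<noteq> None \<and> addr_namespace s a \<noteq> None"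

definition wf0 :: "('d, 'g, 'k) ftl_config \<Rightarrow> bool" where
  "wf0 C \<longleftrightarrow> pages_per_block C > 0"

text \<open>Trivially true, since \<open>page_state\<close> is a total function; kept as a conjunct of
  the invariant all the same.\<close>

definition wf1 :: "('d, 'g, 'k) ftl_config \<Rightarrow> ('d, 'g, 'k) ftl_state \<Rightarrow> bool" where
  "wf1 C s \<longleftrightarrow> (\<forall>y. ppage_ok C y \<longrightarrow> (\<exists>st. page_state s y = st))"

definition inv0 :: "('d, 'g, 'k) ftl_config \<Rightarrow> ('d, 'g, 'k) ftl_state \<Rightarrow> bool" where
  "inv0 C s \<longleftrightarrow> (\<forall>y. ppage_ok C y \<and> live s y \<longrightarrow> (\<exists>x. l2p_map s x = Some y))"

definition inv1 :: "('d, 'g, 'k) ftl_config \<Rightarrow> ('d, 'g, 'k) ftl_state \<Rightarrow> bool" where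
  "inv1 C s \<longleftrightarrow> (\<forall>x y. l2p_map s x = Some y \<longrightarrow> lpage_ok C x \<and> ppage_ok C y)"

definition inv2 :: "('d, 'g, 'k) ftl_state \<Rightarrow> bool" where
  "inv2 s \<longleftrightarrow> (\<forall>x x' y. l2p_map s x = Some y \<and> l2p_map s x' = Some y \<longrightarrow> x = x')"

definition inv3 :: "('d, 'g, 'k) ftl_config \<Rightarrow> ('d, 'g, 'k) ftl_state \<Rightarrow> bool" where
  "inv3 C s \<longleftrightarrow>
     (\<forall>x y. ppage_ok C y \<and> l2p_map s x = Some y \<and> live s y \<longrightarrow> pm_rmap (page_meta s y) = Some x)"

definition inv4 :: "('d, 'g, 'k) ftl_config \<Rightarrow> ('d, 'g, 'k) ftl_state \<Rightarrow> bool" where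
  "inv4 C s \<longleftrightarrow>
     (\<forall>x y. ppage_ok C y \<and> live s y \<and> pm_rmap (page_meta s y) = Some x \<longrightarrow> l2p_map s x = Some y)"

definition inv5 :: "('d, 'g, 'k) ftl_config \<Rightarrow> ('d, 'g, 'k) ftl_state \<Rightarrow> bool" where
  "inv5 C s \<longleftrightarrow> (\<forall>b. in_use C s b \<longrightarrow> b \<notin> set (free_block_list s))"

definition inv6 :: "('d, 'g, 'k) ftl_config \<Rightarrow> ('d, 'g, 'k) ftl_state \<Rightarrow> bool" where
  "inv6 C s \<longleftrightarrow>
     (\<forall>b \<in> set (free_block_list s). \<forall>q < pages_per_block C. erased s (b, q) \<and> no_meta s (b, q))"

definition inv7 :: "('d, 'g, 'k) ftl_config \<Rightarrow> ('d, 'g, 'k) ftl_state \<Rightarrow> bool" where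
  "inv7 C s \<longleftrightarrow>
     (\<forall>a p y. ppage_ok C y \<and> live s y \<and> l2p_map s (a, p) = Some y \<longrightarrow>
        pm_tenant (page_meta s y) = addr_tenant s a \<and>
        pm_namespace (page_meta s y) = addr_namespace s a)"

definition inv8 :: "('d, 'g, 'k) ftl_config \<Rightarrow> ('d, 'g, 'k) ftl_state \<Rightarrow> bool" where
  "inv8 C s \<longleftrightarrow> (\<forall>b \<in> set (free_block_list s). b < total_blocks C)"

definition inv9 :: "('d, 'g, 'k) ftl_config \<Rightarrow> ('d, 'g, 'k) ftl_state \<Rightarrow> bool" where
  "inv9 C s \<longleftrightarrow> (\<forall>y. ppage_ok C y \<and> live s y \<longrightarrow> pm_tag (page_meta s y) \<noteq> None)"

definition inv10 :: "('d, 'g, 'k) ftl_config \<Rightarrow> ('d, 'g, 'k) ftl_state \<Rightarrow> bool" where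
  "inv10 C s \<longleftrightarrow>
     (\<forall>b < total_blocks C.
        b \<in> set (free_block_list s) \<or> block_open s b \<or> in_use C s b \<or> holds_stale C s b)"

definition inv11 :: "('d, 'g, 'k) ftl_state \<Rightarrow> bool" where
  "inv11 s \<longleftrightarrow> distinct (free_block_list s)"

definition inv12 :: "('d, 'g, 'k) ftl_config \<Rightarrow> ('d, 'g, 'k) ftl_state \<Rightarrow> bool" where
  "inv12 C s \<longleftrightarrow>
     (\<forall>b < total_blocks C.
        (\<exists>q < pages_per_block C. page_role s (b, q) = Some RMeta) \<longrightarrow>
        in_use C s b \<or> holds_stale C s b)"

definition inv13 :: "('d, 'g, 'k) ftl_config \<Rightarrow> ('d, 'g, 'k) ftl_state \<Rightarrow> bool" where
  "inv13 C s \<longleftrightarrow> (\<forall>y. ppage_ok C y \<and> live s y \<longrightarrow> page_role s y = Some RData)"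

definition inv14 :: "('d, 'g, 'k) ftl_config \<Rightarrow> ('d, 'g, 'k) ftl_state \<Rightarrow> bool" where
  "inv14 C s \<longleftrightarrow> (\<forall>y. ppage_ok C y \<and> page_role s y = Some RData \<longrightarrow> live s y)"

definition inv15 :: "('d, 'g, 'k) ftl_config \<Rightarrow> ('d, 'g, 'k) ftl_state \<Rightarrow> bool" where
  "inv15 C s \<longleftrightarrow> (\<forall>y. ppage_ok C y \<and> page_role s y = Some RMeta \<longrightarrow> \<not> erased s y)"

definition inv16 :: "('d, 'g, 'k) ftl_config \<Rightarrow> ('d, 'g, 'k) ftl_state \<Rightarrow> bool" where
  "inv16 C s \<longleftrightarrow> (\<forall>y. ppage_ok C y \<and> erased s y \<longrightarrow> page_role s y = None)"

definition inv17 :: "('d, 'g, 'k) ftl_state \<Rightarrow> bool" where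
  "inv17 s \<longleftrightarrow> (\<forall>b. free_block s b \<longrightarrow> block_tenant s b = None \<and> block_namespace s b = None)"

definition inv18 :: "('d, 'g, 'k) ftl_config \<Rightarrow> ('d, 'g, 'k) ftl_state \<Rightarrow> bool" where
  "inv18 C s \<longleftrightarrow>
     (\<forall>a p b q. ppage_ok C (b, q) \<and> l2p_map s (a, p) = Some (b, q) \<longrightarrow>
        block_tenant s b = addr_tenant s a \<and> block_namespace s b = addr_namespace s a)"

definition inv19 :: "('d, 'g, 'k) ftl_config \<Rightarrow> ('d, 'g, 'k) ftl_state \<Rightarrow> bool" where
  "inv19 C s \<longleftrightarrow>
     (\<forall>i r. region_table s i = Some r \<longrightarrow> (\<forall>a \<in> {rg_start r..<rg_end r}. a < addr_space C))"

definition inv20 :: "('d, 'g, 'k) ftl_config \<Rightarrow> ('d, 'g, 'k) ftl_state \<Rightarrow> bool" where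
  "inv20 C s \<longleftrightarrow>
     (\<forall>t n b. open_block s (t, n) = Some b \<longrightarrow>
        b < total_blocks C \<and> \<not> free_block s b \<and> block_open s b \<and>
        write_ptr s (t, n) \<le> pages_per_block C \<and>
        (\<forall>w. open_block s w = Some b \<longrightarrow> w = (t, n)) \<and>
        (block_tenant s b = Some t \<and> block_namespace s b = Some n \<or>
         block_tenant s b = None \<and> block_namespace s b = None))"

definition inv21 :: "('d, 'g, 'k) ftl_config \<Rightarrow> ('d, 'g, 'k) ftl_state \<Rightarrow> bool" where
  "inv21 C s \<longleftrightarrow>
     (\<forall>w b q. open_block s w = Some b \<and> ppage_ok C (b, q) \<and> write_ptr s w \<le> q \<longrightarrow>
        erased s (b, q) \<and> no_meta s (b, q))"

definition inv22 :: "('d, 'g, 'k) ftl_state \<Rightarrow> bool" where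
  "inv22 s \<longleftrightarrow> (\<forall>x y. l2p_map s x = Some y \<longrightarrow> live s y)"

definition inv23 :: "('d, 'g, 'k) ftl_state \<Rightarrow> bool" where
  "inv23 s \<longleftrightarrow> (\<forall>b. block_open s b \<longrightarrow> (\<exists>w. open_block s w = Some b))"

definition inv24 :: "('d, 'g, 'k) ftl_state \<Rightarrow> bool" where
  "inv24 s \<longleftrightarrow> (\<forall>b. free_block s b \<longleftrightarrow> b \<in> set (free_block_list s))"

definition inv25 :: "('d, 'g, 'k) ftl_config \<Rightarrow> ('d, 'g, 'k) ftl_state \<Rightarrow> bool" where
  "inv25 C s \<longleftrightarrow>
     (\<forall>w b q. open_block s w = Some b \<and> ppage_ok C (b, q) \<and> q < write_ptr s w \<longrightarrow>
        \<not> erased s (b, q))"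

definition inv26 :: "('d, 'g, 'k) ftl_state \<Rightarrow> bool" where
  "inv26 s \<longleftrightarrow> (\<forall>a. (\<exists>p. l2p_map s (a, p) \<noteq> None) \<longrightarrow> labelled s a)"

definition ftl_invariant :: "('d, 'g, 'k) ftl_config \<Rightarrow> ('d, 'g, 'k) ftl_state \<Rightarrow> bool" where
  "ftl_invariant C s \<longleftrightarrow>
     wf0 C \<and> wf1 C s \<and>
     inv0 C s \<and> inv1 C s \<and> inv2 s \<and> inv3 C s \<and> inv4 C s \<and> inv5 C s \<and> inv6 C s \<and>
     inv7 C s \<and> inv8 C s \<and> inv9 C s \<and> inv10 C s \<and> inv11 s \<and> inv12 C s \<and> inv13 C s \<and>
     inv14 C s \<and> inv15 C s \<and> inv16 C s \<and> inv17 s \<and> inv18 C s \<and> inv19 C s \<and>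
     inv20 C s \<and> inv21 C s \<and> inv22 s \<and> inv23 s \<and> inv24 s \<and> inv25 C s \<and> inv26 s"


section \<open>Operations\<close>

datatype ('d, 'g) op =
    COpRead nat nat
  | COpWrite nat nat 'd
  | COpInvalidate nat nat
  | COpSetTag nat nat 'g
  | COpGC
  | COpWearLevel

definition invalidate :: "('d, 'g, 'k) ftl_state \<Rightarrow> lpage \<Rightarrow> ('d, 'g, 'k) ftl_state" where
  "invalidate s x = (case l2p_map s x of
      None \<Rightarrow> s
    | Some y \<Rightarrow> s\<lparr>page_state := (page_state s)(y := PS_Invalid),
                 page_role := (page_role s)(y := None),
                 l2p_map := (l2p_map s)(x := None)\<rparr>)"

definition fresh_block ::
  "('d, 'g, 'k) ftl_state \<Rightarrow> owner \<Rightarrow> (('d, 'g, 'k) ftl_state \<times> ppage) option" where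
  "fresh_block s w = (case free_block_list s of
      [] \<Rightarrow> None
    | b # bs \<Rightarrow>
        let closed = (case open_block s w of
                        None \<Rightarrow> block_open s
                      | Some b' \<Rightarrow> (block_open s)(b' := False))
        in Some (s\<lparr>free_block_list := bs,
                   free_block := (free_block s)(b := False),
                   block_open := closed(b := True),
                   open_block := (open_block s)(w := Some b),
                   write_ptr := (write_ptr s)(w := 0)\<rparr>, (b, 0)))"

definition destination ::
  "('d, 'g, 'k) ftl_config \<Rightarrow> ('d, 'g, 'k) ftl_state \<Rightarrow> owner
     \<Rightarrow> (('d, 'g, 'k) ftl_state \<times> ppage) option" where
  "destination C s w = (case open_block s w of
      None \<Rightarrow> fresh_block s w
    | Some b \<Rightarrow> if write_ptr s w < pages_per_block C then Some (s, (b, write_ptr s w))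
                else fresh_block s w)"

text \<open>The tag is passed as an option because relocation copies the tag component of
  the old page unchanged, whether or not it is present.\<close>

definition place ::
  "('d, 'g, 'k) ftl_config \<Rightarrow> ('d, 'g, 'k) ftl_state \<Rightarrow> lpage \<Rightarrow> 'd \<Rightarrow> 'g option
     \<Rightarrow> ('d, 'g, 'k) ftl_state option" where
  "place C s x d g = (case (addr_tenant s (fst x), addr_namespace s (fst x)) of
      (Some t, Some n) \<Rightarrow>
        (case destination C s (t, n) of
           None \<Rightarrow> None
         | Some (s', (b, q)) \<Rightarrow>
             Some (s'\<lparr>page_state := (page_state s')((b, q) := PS_Valid d),
                      page_role := (page_role s')((b, q) := Some RData),
                      page_meta := (page_meta s')((b, q) :=
                        \<lparr>pm_tenant = Some t, pm_namespace = Some n, pm_tag = g, pm_rmap = Some x\<rparr>),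
                      block_tenant := (block_tenant s')(b := Some t),
                      block_namespace := (block_namespace s')(b := Some n),
                      write_ptr := (write_ptr s')((t, n) := q + 1),
                      l2p_map := (l2p_map s')(x := Some (b, q))\<rparr>))
    | _ \<Rightarrow> None)"

definition erase ::
  "('d, 'g, 'k) ftl_config \<Rightarrow> ('d, 'g, 'k) ftl_state \<Rightarrow> nat \<Rightarrow> ('d, 'g, 'k) ftl_state" where
  "erase C s b =
     (let in_b = (\<lambda>y. fst y = b \<and> snd y < pages_per_block C) in
      s\<lparr>page_state := (\<lambda>y. if in_b y then PS_Empty else page_state s y),
        page_role := (\<lambda>y. if in_b y then None else page_role s y),
        page_meta := (\<lambda>y. if in_b y
          then \<lparr>pm_tenant = None, pm_namespace = None, pm_tag = None, pm_rmap = None\<rparr>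
          else page_meta s y),
        block_tenant := (block_tenant s)(b := None),
        block_namespace := (block_namespace s)(b := None),
        wear_count := (wear_count s)(b := wear_count s b + 1),
        free_block_list := b # free_block_list s,
        free_block := (free_block s)(b := True)\<rparr>)"

text \<open>Relocating a page that is not live does nothing; relocating a live page that has
  no reverse mapping fails.\<close>

definition relocate_page ::
  "('d, 'g, 'k) ftl_config \<Rightarrow> ('d, 'g, 'k) ftl_state \<Rightarrow> ppage \<Rightarrow> ('d, 'g, 'k) ftl_state option" where
  "relocate_page C s y = (case page_state s y of
      PS_Valid d \<Rightarrow>
        (case pm_rmap (page_meta s y) of
           None \<Rightarrow> None
         | Some x \<Rightarrow> place C (invalidate s x) x d (pm_tag (page_meta s y)))
    | _ \<Rightarrow> Some s)"

fun relocate_pages ::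
  "('d, 'g, 'k) ftl_config \<Rightarrow> ('d, 'g, 'k) ftl_state \<Rightarrow> ppage list \<Rightarrow> ('d, 'g, 'k) ftl_state option" where
  "relocate_pages C s [] = Some s"
| "relocate_pages C s (y # ys) = (case relocate_page C s y of
      None \<Rightarrow> None
    | Some s' \<Rightarrow> relocate_pages C s' ys)"

definition reclaim ::
  "('d, 'g, 'k) ftl_config \<Rightarrow> (('d, 'g, 'k) ftl_state \<Rightarrow> nat option) \<Rightarrow> ('d, 'g, 'k) ftl_state
     \<Rightarrow> ('d, 'g, 'k) ftl_state option" where
  "reclaim C sel s = (case sel s of
      None \<Rightarrow> None
    | Some v \<Rightarrow>
        (case relocate_pages C s (map (Pair v) [0..<pages_per_block C]) of
           None \<Rightarrow> None
         | Some s' \<Rightarrow> Some (erase C s' v)))"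

definition write_page ::
  "('d, 'g, 'k) ftl_config \<Rightarrow> ('d, 'g, 'k) ftl_state \<Rightarrow> lpage \<Rightarrow> 'd \<Rightarrow> ('d, 'g, 'k) ftl_state option" where
  "write_page C s x d =
     (if lpage_ok C x \<and> labelled s (fst x) then place C (invalidate s x) x d (Some (tag_of C d))
      else None)"

definition set_tag :: "('d, 'g, 'k) ftl_state \<Rightarrow> lpage \<Rightarrow> 'g \<Rightarrow> ('d, 'g, 'k) ftl_state" where
  "set_tag s x g = (case l2p_map s x of
      None \<Rightarrow> s
    | Some y \<Rightarrow>
        if live s y
        then s\<lparr>page_meta := (page_meta s)(y := (page_meta s y)\<lparr>pm_tag := Some g\<rparr>)\<rparr>
        else s)"

fun step ::
  "('d, 'g, 'k) ftl_config \<Rightarrow> ('d, 'g, 'k) ftl_state \<Rightarrow> ('d, 'g) op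
     \<Rightarrow> ('d, 'g, 'k) ftl_state option" where
  "step C s (COpRead a p) = Some s"
| "step C s (COpWrite a p d) = write_page C s (a, p) d"
| "step C s (COpInvalidate a p) = Some (invalidate s (a, p))"
| "step C s (COpSetTag a p g) = Some (set_tag s (a, p) g)"
| "step C s COpGC = reclaim C (gc_victim C) s"
| "step C s COpWearLevel = reclaim C (wl_victim C) s"

fun exec ::
  "('d, 'g, 'k) ftl_config \<Rightarrow> ('d, 'g, 'k) ftl_state \<Rightarrow> ('d, 'g) op list
     \<Rightarrow> ('d, 'g, 'k) ftl_state option" where
  "exec C s [] = Some s"
| "exec C s (\<sigma> # ops) = (case step C s \<sigma> of None \<Rightarrow> None | Some s' \<Rightarrow> exec C s' ops)"


section \<open>Abstract device and refinement\<close>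

fun abs_step :: "(lpage \<rightharpoonup> 'd) \<Rightarrow> ('d, 'g) op \<Rightarrow> (lpage \<rightharpoonup> 'd)" where
  "abs_step h (COpRead a p) = h"
| "abs_step h (COpWrite a p d) = h((a, p) := Some d)"
| "abs_step h (COpInvalidate a p) = h((a, p) := None)"
| "abs_step h (COpSetTag a p g) = h"
| "abs_step h COpGC = h"
| "abs_step h COpWearLevel = h"

fun abs_exec :: "(lpage \<rightharpoonup> 'd) \<Rightarrow> ('d, 'g) op list \<Rightarrow> (lpage \<rightharpoonup> 'd)" where
  "abs_exec h [] = h"
| "abs_exec h (\<sigma> # ops) = abs_exec (abs_step h \<sigma>) ops"

definition refines :: "(lpage \<rightharpoonup> 'd) \<Rightarrow> ('d, 'g, 'k) ftl_state \<Rightarrow> bool" where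
  "refines h s \<longleftrightarrow>
     (\<forall>a p d. h (a, p) = Some d \<longrightarrow>
        (\<exists>b q. l2p_map s (a, p) = Some (b, q) \<and> page_state s (b, q) = PS_Valid d))"

end

(* Every auxiliary step preserves the invariant by itself, including the two intermediate states
   that are not results of an operation: the one after invalidation and the one after a fresh
   block has been opened but not yet written. Writing then always goes to the frontier of an
   open block, an erased and hence unmapped page. During reclamation the victim stays outside
   the free list and unopened, so relocated pages never land in it; it ends up without live
   pages, hence unmapped, and erasing it loses no data. *)

theory Submission
  imports Defs
begin

declare split_paired_All [simp del] split_paired_Ex [simp del]

section \<open>Reading off the invariant\<close>

text \<open>\<open>wf1\<close> comes from \<open>wf1_trivial\<close> instead, so in later proofs
  \<open>I(1)\<close> is \<open>wf0\<close> and \<open>I(k + 2)\<close> is clause \<open>k\<close>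
  of the invariant.\<close>

lemma ftl_invariantD:
  assumes "ftl_invariant C s"
  shows "wf0 C" "inv0 C s" "inv1 C s" "inv2 s" "inv3 C s" "inv4 C s" "inv5 C s" "inv6 C s"
    "inv7 C s" "inv8 C s" "inv9 C s" "inv10 C s" "inv11 s" "inv12 C s" "inv13 C s"
    "inv14 C s" "inv15 C s" "inv16 C s" "inv17 s" "inv18 C s" "inv19 C s" "inv20 C s"
    "inv21 C s" "inv22 s" "inv23 s" "inv24 s" "inv25 C s" "inv26 s"
  using assms unfolding ftl_invariant_def by blast+

lemma wf1_trivial: "wf1 C s"
  by (simp add: wf1_def)

lemmas page_defs = live_def stale_def erased_def no_meta_def

text \<open>Collects what clauses 1, 2, 18, 22 and 26 say about one entry of the map; the bounds
  from \<open>inv1\<close> discharge the guard of \<open>inv18\<close>.\<close>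

lemma mapped_pageD:
  assumes "ftl_invariant C s" and "l2p_map s x = Some y"
  shows "lpage_ok C x" "ppage_ok C y" "live s y" "labelled s (fst x)"
    "\<And>x'. l2p_map s x' = Some y \<Longrightarrow> x' = x"
    "block_tenant s (fst y) = addr_tenant s (fst x)"
    "block_namespace s (fst y) = addr_namespace s (fst x)"
proof -
  note I = ftl_invariantD[OF assms(1)]
  show ok: "lpage_ok C x" "ppage_ok C y" using I(3) assms(2) unfolding inv1_def by blast+
  show l: "live s y" using I(24) assms(2) unfolding inv22_def by blast
  show "labelled s (fst x)" using I(28) assms(2) unfolding inv26_def
    by (metis option.distinct(1) prod.collapse)
  show "\<And>x'. l2p_map s x' = Some y \<Longrightarrow> x' = x" using I(4) assms(2) unfolding inv2_def by blast
  show "block_tenant s (fst y) = addr_tenant s (fst x)"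
    "block_namespace s (fst y) = addr_namespace s (fst x)"
    using I(20) assms(2) ok unfolding inv18_def by (metis prod.collapse)+
qed

section \<open>Invalidation\<close>

lemma invalidate_simps [simp]:
  "page_meta (invalidate s x) = page_meta s"
  "addr_tenant (invalidate s x) = addr_tenant s"
  "addr_namespace (invalidate s x) = addr_namespace s"
  "block_tenant (invalidate s x) = block_tenant s"
  "block_namespace (invalidate s x) = block_namespace s"
  "region_table (invalidate s x) = region_table s"
  "free_block_list (invalidate s x) = free_block_list s"
  "free_block (invalidate s x) = free_block s"
  "open_block (invalidate s x) = open_block s"
  "write_ptr (invalidate s x) = write_ptr s"
  "block_open (invalidate s x) = block_open s"
  "l2p_map (invalidate s x) = (l2p_map s)(x := None)"
  by (auto simp: invalidate_def fun_upd_idem split: option.split)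

lemma invalidate_page_state:
  "l2p_map s x = Some y \<Longrightarrow> page_state (invalidate s x) = (page_state s)(y := PS_Invalid)"
  "l2p_map s x = Some y \<Longrightarrow> page_role (invalidate s x) = (page_role s)(y := None)"
  by (simp_all add: invalidate_def)

lemma invalidate_unmapped: "l2p_map s x = None \<Longrightarrow> invalidate s x = s"
  by (simp add: invalidate_def)

text \<open>The page \<open>y\<close> behind \<open>x\<close> turns from live to stale and loses its
  only logical page. Clauses guarded by liveness thus speak of fewer pages, and only clauses 10 and
  12, which want a mapped or stale page in a block, need an argument.\<close>

lemma ftl_invariant_invalidate:
  assumes "ftl_invariant C s"
  shows "ftl_invariant C (invalidate s x)"
proof (cases "l2p_map s x")
  case None
  then show ?thesis using assms by (simp add: invalidate_unmapped)
next
  case (Some y)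
  let ?s = "invalidate s x"
  note I = ftl_invariantD[OF assms]
  note M = mapped_pageD[OF assms Some]
  note upd = invalidate_page_state[OF Some]
  have lv: "live ?s z \<longleftrightarrow> live s z \<and> z \<noteq> y" for z by (auto simp: live_def upd)
  have st: "stale ?s z \<longleftrightarrow> stale s z \<or> z = y" for z by (auto simp: stale_def upd)
  \<comment> \<open>\<open>y\<close> was live and becomes stale, so it is erased neither before nor
    after.\<close>
  have er: "erased ?s z \<longleftrightarrow> erased s z" for z
    using M(3) by (auto simp: erased_def live_def upd)
  have nm: "no_meta ?s z \<longleftrightarrow> no_meta s z" for z by (simp add: no_meta_def)
  have nomap: "l2p_map s z \<noteq> Some y" if "z \<noteq> x" for z using M(5) that by blast
  have mp: "mapped ?s z \<longleftrightarrow> mapped s z \<and> z \<noteq> y" for z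
    using nomap Some by (auto simp: mapped_def) (metis option.inject)
  have iu: "in_use C ?s b \<Longrightarrow> in_use C s b" for b by (auto simp: in_use_def mp)
  \<comment> \<open>If \<open>y\<close> was the only mapped page of its block, it now serves as the
    stale page.\<close>
  have us: "in_use C s b \<or> holds_stale C s b \<Longrightarrow> in_use C ?s b \<or> holds_stale C ?s b" for b
    by (auto simp: in_use_def holds_stale_def mp st)
  have lab: "labelled ?s a = labelled s a" for a by (simp add: labelled_def)
  show ?thesis
    unfolding ftl_invariant_def
  proof (intro conjI wf1_trivial)
    show "wf0 C" by (fact I(1))
    show "inv0 C ?s" using I(2) Some unfolding inv0_def lv
      by simp (metis option.inject)
    show "inv1 C ?s" using I(3) by (simp add: inv1_def)
    show "inv2 ?s" using I(4) by (simp add: inv2_def)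
    show "inv3 C ?s" using I(5) by (simp add: inv3_def lv)
    show "inv4 C ?s" using I(6) Some unfolding inv4_def lv by simp (metis option.inject)
    show "inv5 C ?s" using I(7) iu by (auto simp: inv5_def)
    show "inv6 C ?s" using I(8) by (simp add: inv6_def er nm)
    show "inv7 C ?s" using I(9) by (auto simp: inv7_def lv)
    show "inv8 C ?s" using I(10) by (simp add: inv8_def)
    show "inv9 C ?s" using I(11) by (simp add: inv9_def lv)
    show "inv10 C ?s" using I(12) us unfolding inv10_def by simp blast
    show "inv11 ?s" using I(13) by (simp add: inv11_def)
    show "inv12 C ?s" using I(14) us unfolding inv12_def
      by (simp add: upd split: if_splits) blast
    show "inv13 C ?s" using I(15) by (simp add: inv13_def lv upd)
    show "inv14 C ?s" using I(16) by (simp add: inv14_def lv upd)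
    show "inv15 C ?s" using I(17) by (simp add: inv15_def er upd)
    show "inv16 C ?s" using I(18) by (simp add: inv16_def er upd)
    show "inv17 ?s" using I(19) by (simp add: inv17_def)
    show "inv18 C ?s" using I(20) by (simp add: inv18_def)
    show "inv19 C ?s" using I(21) by (simp add: inv19_def)
    show "inv20 C ?s" using I(22) by (simp add: inv20_def)
    show "inv21 C ?s" using I(23) by (simp add: inv21_def er nm)
    show "inv22 ?s" using I(24) nomap by (simp add: inv22_def lv) blast
    show "inv23 ?s" using I(25) by (simp add: inv23_def)
    show "inv24 ?s" using I(26) by (simp add: inv24_def)
    show "inv25 C ?s" using I(27) by (simp add: inv25_def er)
    show "inv26 ?s" using I(28) by (auto simp: inv26_def lab)
  qed
qed

lemma refines_mono: "h \<subseteq>\<^sub>m h' \<Longrightarrow> refines h' s \<Longrightarrow> refines h s"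
  unfolding refines_def map_le_def by (metis domI)

text \<open>By injectivity of the map, no logical page other than \<open>x\<close> reads the page
  that turns stale, so deleting \<open>x\<close> from \<open>h\<close> compensates for the whole
  loss.\<close>

lemma refines_invalidate:
  assumes "ftl_invariant C s" and "refines h s"
  shows "refines (h(x := None)) (invalidate s x)"
proof (cases "l2p_map s x")
  case None
  then show ?thesis using assms by (auto simp: invalidate_unmapped refines_def)
next
  case (Some y)
  then have "l2p_map s z \<noteq> Some y" if "z \<noteq> x" for z
    using mapped_pageD(5)[OF assms(1)] that by blast
  then show ?thesis
    using assms(2) unfolding refines_def invalidate_page_state[OF Some] invalidate_simps
    by (metis fun_upd_apply option.distinct(1))
qed

section \<open>Opening a block and choosing the destination\<close>

text \<open>Closing the old block and opening \<open>b\<close> are merged into one predicate. The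
  disjunct \<open>c = b\<close> overrides the rest, because opening comes after closing.\<close>

lemma fresh_blockD:
  assumes "fresh_block s w = Some (s', y)"
  obtains b bs where "free_block_list s = b # bs" and "y = (b, 0)"
    and "s' = s\<lparr>free_block_list := bs,
           free_block := (free_block s)(b := False),
           block_open := (\<lambda>c. c = b \<or> block_open s c \<and> open_block s w \<noteq> Some c),
           open_block := (open_block s)(w := Some b),
           write_ptr := (write_ptr s)(w := 0)\<rparr>"
proof (cases "free_block_list s")
  case Nil
  then show ?thesis using assms by (simp add: fresh_block_def)
next
  case (Cons b bs)
  have "(case open_block s w of None \<Rightarrow> block_open s | Some b' \<Rightarrow> (block_open s)(b' := False))(b := True)
      = (\<lambda>c. c = b \<or> block_open s c \<and> open_block s w \<noteq> Some c)"
    by (cases "open_block s w") (auto simp: fun_eq_iff)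
  then show ?thesis using that Cons assms by (simp add: fresh_block_def)
qed

text \<open>A block from the free list brings what clauses 20, 21 and 25 ask at frontier 0: no
  owner, erased pages without metadata, and nothing below the frontier. \<open>full\<close> lets the
  previous block be closed without breaking clause 10.\<close>

lemma ftl_invariant_fresh_block:
  assumes inv: "ftl_invariant C s" and fresh: "fresh_block s w = Some (s', y)"
    and full: "\<And>b. open_block s w = Some b \<Longrightarrow> \<not> write_ptr s w < pages_per_block C"
  shows "ftl_invariant C s'"
proof -
  note I = ftl_invariantD[OF inv]
  from fresh obtain b bs where fl: "free_block_list s = b # bs"
    and s': "s' = s\<lparr>free_block_list := bs,
           free_block := (free_block s)(b := False),
           block_open := (\<lambda>c. c = b \<or> block_open s c \<and> open_block s w \<noteq> Some c),
           open_block := (open_block s)(w := Some b),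
           write_ptr := (write_ptr s)(w := 0)\<rparr>"
    by (rule fresh_blockD)
  have pg: "live s' = live s" "stale s' = stale s" "erased s' = erased s" "no_meta s' = no_meta s"
    "mapped s' = mapped s" "in_use C s' = in_use C s" "holds_stale C s' = holds_stale C s"
    "labelled s' = labelled s"
    by (auto simp: fun_eq_iff page_defs mapped_def in_use_def holds_stale_def labelled_def s')
  have b: "b < total_blocks C" "b \<notin> set bs" "free_block s b" "block_tenant s b = None"
    "block_namespace s b = None"
    using I(10,13,19,26) fl by (auto simp: inv8_def inv11_def inv17_def inv24_def)
  \<comment> \<open>Open blocks are not free by \<open>inv20\<close>, so \<open>b\<close> has no
    earlier owner and ownership stays unique.\<close>
  have nopen: "open_block s w' \<noteq> Some b" for w'
    using I(22) b(3) by (cases w') (auto simp: inv20_def)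
  have b_empty: "erased s (b, q)" "no_meta s (b, q)" if "q < pages_per_block C" for q
    using I(8) fl that by (simp_all add: inv6_def)
  \<comment> \<open>A block is closed only when full, and then its page 0 is live, hence mapped, or stale.\<close>
  have closed: "in_use C s c \<or> holds_stale C s c" if c: "open_block s w = Some c" for c
  proof -
    have "0 < pages_per_block C" using I(1) by (simp add: wf0_def)
    moreover have "c < total_blocks C" using I(22) c by (cases w) (auto simp: inv20_def)
    moreover note full[OF c]
    ultimately have ok: "ppage_ok C (c, 0)" and "0 < write_ptr s w" by (auto simp: ppage_ok_def)
    then have "\<not> erased s (c, 0)" using I(27) c by (auto simp: inv25_def)
    then have "live s (c, 0) \<or> stale s (c, 0)"
      by (cases "page_state s (c, 0)") (auto simp: page_defs)
    then show ?thesis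
      using I(2) ok \<open>0 < pages_per_block C\<close>
      unfolding inv0_def in_use_def holds_stale_def mapped_def by blast
  qed
  show ?thesis
    unfolding ftl_invariant_def
  proof (intro conjI wf1_trivial)
    show "wf0 C" by (fact I(1))
    show "inv0 C s'" using I(2) by (simp add: inv0_def pg) (simp add: s')
    show "inv1 C s'" using I(3) by (simp add: inv1_def s')
    show "inv2 s'" using I(4) by (simp add: inv2_def s')
    show "inv3 C s'" using I(5) by (simp add: inv3_def pg) (simp add: s')
    show "inv4 C s'" using I(6) by (simp add: inv4_def pg) (simp add: s')
    show "inv5 C s'" using I(7) fl by (simp add: inv5_def pg) (simp add: s')
    show "inv6 C s'" using I(8) fl by (simp add: inv6_def pg) (simp add: s')
    show "inv7 C s'" using I(9) by (simp add: inv7_def pg) (simp add: s')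
    show "inv8 C s'" using I(10) fl by (simp add: inv8_def s')
    show "inv9 C s'" using I(11) by (simp add: inv9_def pg) (simp add: s')
    show "inv10 C s'" using I(12) fl closed unfolding inv10_def pg by (simp add: s') blast
    show "inv11 s'" using I(13) fl by (simp add: inv11_def s')
    show "inv12 C s'" using I(14) by (simp add: inv12_def pg) (simp add: s')
    show "inv13 C s'" using I(15) by (simp add: inv13_def pg) (simp add: s')
    show "inv14 C s'" using I(16) by (simp add: inv14_def pg) (simp add: s')
    show "inv15 C s'" using I(17) by (simp add: inv15_def pg) (simp add: s')
    show "inv16 C s'" using I(18) by (simp add: inv16_def pg) (simp add: s')
    show "inv17 s'" using I(19) by (simp add: inv17_def s')
    show "inv18 C s'" using I(20) by (simp add: inv18_def s')
    show "inv19 C s'" using I(21) by (simp add: inv19_def s')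
    show "inv20 C s'" using I(22) b nopen by (auto simp: inv20_def s')
    show "inv21 C s'" using I(23) b_empty
      unfolding inv21_def pg by (auto simp: s' ppage_ok_def)
    show "inv22 s'" using I(24) by (simp add: inv22_def pg) (simp add: s')
    show "inv23 s'" using I(25) by (simp add: inv23_def s') metis
    show "inv24 s'" using I(26) b(2) fl by (auto simp: inv24_def s')
    show "inv25 C s'" using I(27) unfolding inv25_def pg by (auto simp: s')
    show "inv26 s'" using I(28) by (simp add: inv26_def pg) (simp add: s')
  qed
qed

lemma destination_frame:
  assumes "destination C s w = Some (s', y)"
  shows "l2p_map s' = l2p_map s" "page_state s' = page_state s"
    "addr_tenant s' = addr_tenant s" "addr_namespace s' = addr_namespace s"
  using assms
  by (auto simp: destination_def split: option.splits if_splits elim!: fresh_blockD)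

text \<open>A fresh block is requested only if the owner has no open block or its frontier has
  reached the end; this gives the premise \<open>full\<close>.\<close>

lemma ftl_invariant_destination:
  assumes "ftl_invariant C s" and "destination C s w = Some (s', y)"
  shows "ftl_invariant C s'"
  using assms
  by (auto simp: destination_def split: option.splits if_splits
      intro: ftl_invariant_fresh_block[OF assms(1)])

text \<open>Opening a fresh block resets the frontier to 0, an offset that exists because blocks are
  nonempty. Both branches of \<open>destination\<close> thus look alike afterwards, and the write
  needs no case split.\<close>

lemma destination_frontier:
  assumes "0 < pages_per_block C" and "destination C s w = Some (s', (b, q))"
  shows "open_block s' w = Some b" "q = write_ptr s' w" "q < pages_per_block C"
  using assms
  by (auto simp: destination_def split: option.splits if_splits elim!: fresh_blockD)

text \<open>The destination block is either open already or the head of the free list, and a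
  reclaimable block is neither. Only that block becomes open and the free list only shrinks, so
  \<open>v\<close> stays reclaimable.\<close>

lemma destination_reclaimable:
  assumes "ftl_invariant C s" and "destination C s w = Some (s', (b, q))"
    and "reclaimable C s v"
  shows "reclaimable C s' v" "b \<noteq> v"
proof -
  have "block_open s c" if "open_block s w = Some c" for c
    using ftl_invariantD(22)[OF assms(1)] that by (cases w) (auto simp: inv20_def)
  with assms(2,3) show "reclaimable C s' v" "b \<noteq> v"
    by (auto simp: destination_def reclaimable_def split: option.splits if_splits
        elim!: fresh_blockD)
qed

section \<open>Writing at the frontier\<close>

text \<open>The second half of \<open>place\<close>, split off so that it starts from the state
  returned by \<open>destination\<close>, which satisfies the invariant again.\<close>

definition store ::
  "('d, 'g, 'k) ftl_state \<Rightarrow> owner \<Rightarrow> ppage \<Rightarrow> lpage \<Rightarrow> 'd \<Rightarrow> 'g option \<Rightarrow> ('d, 'g, 'k) ftl_state"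
  where "store s w y x d g =
    s\<lparr>page_state := (page_state s)(y := PS_Valid d),
      page_role := (page_role s)(y := Some RData),
      page_meta := (page_meta s)(y :=
        \<lparr>pm_tenant = Some (fst w), pm_namespace = Some (snd w), pm_tag = g, pm_rmap = Some x\<rparr>),
      block_tenant := (block_tenant s)(fst y := Some (fst w)),
      block_namespace := (block_namespace s)(fst y := Some (snd w)),
      write_ptr := (write_ptr s)(w := snd y + 1),
      l2p_map := (l2p_map s)(x := Some y)\<rparr>"

lemma store_simps [simp]:
  "page_state (store s w y x d g) = (page_state s)(y := PS_Valid d)"
  "page_role (store s w y x d g) = (page_role s)(y := Some RData)"
  "page_meta (store s w y x d g) = (page_meta s)(y :=
     \<lparr>pm_tenant = Some (fst w), pm_namespace = Some (snd w), pm_tag = g, pm_rmap = Some x\<rparr>)"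
  "addr_tenant (store s w y x d g) = addr_tenant s"
  "addr_namespace (store s w y x d g) = addr_namespace s"
  "block_tenant (store s w y x d g) = (block_tenant s)(fst y := Some (fst w))"
  "block_namespace (store s w y x d g) = (block_namespace s)(fst y := Some (snd w))"
  "region_table (store s w y x d g) = region_table s"
  "free_block_list (store s w y x d g) = free_block_list s"
  "free_block (store s w y x d g) = free_block s"
  "open_block (store s w y x d g) = open_block s"
  "write_ptr (store s w y x d g) = (write_ptr s)(w := snd y + 1)"
  "block_open (store s w y x d g) = block_open s"
  "l2p_map (store s w y x d g) = (l2p_map s)(x := Some y)"
  by (simp_all add: store_def)

lemma placeD:
  assumes "place C s x d g = Some s'"
  obtains t n s1 y where "addr_tenant s (fst x) = Some t" "addr_namespace s (fst x) = Some n"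
    "destination C s (t, n) = Some (s1, y)" "s' = store s1 (t, n) y x d g"
  using assms by (auto simp: place_def store_def split: option.splits)

text \<open>\<open>inv21\<close> makes the frontier page erased, whereas \<open>inv22\<close> makes
  every mapped page live.\<close>

lemma frontier_unmapped:
  assumes inv: "ftl_invariant C s" and "open_block s w = Some b"
    and "write_ptr s w < pages_per_block C"
  shows "ppage_ok C (b, write_ptr s w)" "erased s (b, write_ptr s w)"
    "l2p_map s x \<noteq> Some (b, write_ptr s w)"
proof -
  note I = ftl_invariantD[OF inv]
  show ok: "ppage_ok C (b, write_ptr s w)"
    using I(22) assms(2,3) by (cases w) (auto simp: inv20_def ppage_ok_def)
  show er: "erased s (b, write_ptr s w)"
    using I(23) assms(2) ok by (auto simp: inv21_def)
  show "l2p_map s x \<noteq> Some (b, write_ptr s w)"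
    using mapped_pageD(3)[OF inv, of x] er by (auto simp: page_defs)
qed

text \<open>One erased, unmapped page becomes live, and the frontier moves past exactly this page.
  Since \<open>x\<close> was unmapped, no live page loses its logical page (clauses 0 and 4); the
  tag is required for clause 9.\<close>

lemma ftl_invariant_store:
  assumes inv: "ftl_invariant C s"
    and op: "open_block s w = Some b" and q: "q = write_ptr s w" "q < pages_per_block C"
    and x: "lpage_ok C x" "l2p_map s x = None"
      "addr_tenant s (fst x) = Some (fst w)" "addr_namespace s (fst x) = Some (snd w)"
    and g: "g \<noteq> None"
  shows "ftl_invariant C (store s w (b, q) x d g)"
proof -
  let ?s = "store s w (b, q) x d g"
  note I = ftl_invariantD[OF inv]
  note F = frontier_unmapped[OF inv op q(2)[unfolded q(1)], folded q(1)]
  obtain t n where w: "w = (t, n)" by fastforce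
  have B: "b < total_blocks C" "\<not> free_block s b" "block_open s b"
    "\<And>w'. open_block s w' = Some b \<Longrightarrow> w' = w"
    "block_tenant s b = Some t \<and> block_namespace s b = Some n \<or>
     block_tenant s b = None \<and> block_namespace s b = None"
    using I(22) op unfolding inv20_def w by blast+
  have bfree: "b \<notin> set (free_block_list s)" using I(26) B(2) by (simp add: inv24_def)
  have lv: "live ?s z \<longleftrightarrow> live s z \<or> z = (b, q)" for z by (auto simp: live_def)
  \<comment> \<open>The overwritten page was erased, so no stale page disappears.\<close>
  have st: "stale ?s z \<longleftrightarrow> stale s z" for z using F(2) by (auto simp: page_defs)
  have er: "erased ?s z \<longleftrightarrow> erased s z \<and> z \<noteq> (b, q)" for z by (auto simp: page_defs)
  have nm: "no_meta ?s z \<longleftrightarrow> no_meta s z \<and> z \<noteq> (b, q)" for z by (auto simp: no_meta_def)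
  have mp: "mapped ?s z \<longleftrightarrow> mapped s z \<or> z = (b, q)" for z
    using x(2) unfolding mapped_def store_simps
    by (metis fun_upd_apply option.distinct(1) option.inject)
  have iu: "in_use C ?s c \<longleftrightarrow> in_use C s c \<or> c = b" for c
    using q(2) by (auto simp: in_use_def mp)
  have hs: "holds_stale C ?s c \<longleftrightarrow> holds_stale C s c" for c by (simp add: holds_stale_def st)
  have lab: "labelled ?s a = labelled s a" for a by (simp add: labelled_def)
  \<comment> \<open>If \<open>b\<close> has no owner yet, then no page of it is mapped, since mapped addresses are labelled.\<close>
  have own: "addr_tenant s a = Some t \<and> addr_namespace s a = Some n"
    if "l2p_map s (a, p) = Some (b, r)" for a p r
    using mapped_pageD(4,6,7)[OF inv that] B(5) by (auto simp: labelled_def)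
  show ?thesis
    unfolding ftl_invariant_def
  proof (intro conjI wf1_trivial)
    show "wf0 C" by (fact I(1))
    show "inv0 C ?s" using I(2) x(2) unfolding inv0_def lv
      by simp (metis option.distinct(1))
    show "inv1 C ?s" using I(3) x(1) F(1) by (auto simp: inv1_def)
    show "inv2 ?s" using I(4) F(3) by (auto simp: inv2_def)
    show "inv3 C ?s" using I(5) F(3) by (auto simp: inv3_def lv)
    show "inv4 C ?s" using I(6) x(2) F(3) by (auto simp: inv4_def lv)
    show "inv5 C ?s" using I(7) bfree by (auto simp: inv5_def iu)
    show "inv6 C ?s" using I(8) bfree by (auto simp: inv6_def er nm)
    show "inv7 C ?s" using I(9) F(3) x by (auto simp: inv7_def lv)
    show "inv8 C ?s" using I(10) by (simp add: inv8_def)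
    show "inv9 C ?s" using I(11) g by (auto simp: inv9_def lv)
    show "inv10 C ?s" using I(12) by (auto simp: inv10_def iu hs)
    show "inv11 ?s" using I(13) by (simp add: inv11_def)
    show "inv12 C ?s" using I(14) unfolding inv12_def iu hs by (auto split: if_splits)
    show "inv13 C ?s" using I(15) by (auto simp: inv13_def lv)
    show "inv14 C ?s" using I(16) by (auto simp: inv14_def lv)
    show "inv15 C ?s" using I(17) by (auto simp: inv15_def er)
    show "inv16 C ?s" using I(18) by (auto simp: inv16_def er)
    show "inv17 ?s" using I(19) B(2) by (auto simp: inv17_def)
    show "inv18 C ?s" using I(20) own x(3,4) w by (auto simp: inv18_def)
    show "inv19 C ?s" using I(21) by (simp add: inv19_def)
    show "inv20 C ?s"
      unfolding inv20_def store_simps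
    proof (intro allI impI)
      fix t' n' c assume c: "open_block s (t', n') = Some c"
      \<comment> \<open>\<open>b\<close> is open for \<open>w\<close> alone and \<open>w\<close> has
        no other open block, so the new labels of \<open>b\<close> only concern the owner
        \<open>w\<close>.\<close>
      then have cb: "c = b \<longleftrightarrow> (t', n') = w" by (metis B(4) op option.inject)
      from c have K: "c < total_blocks C" "\<not> free_block s c" "block_open s c"
        "write_ptr s (t', n') \<le> pages_per_block C"
        "\<forall>w'. open_block s w' = Some c \<longrightarrow> w' = (t', n')"
        "block_tenant s c = Some t' \<and> block_namespace s c = Some n' \<or>
         block_tenant s c = None \<and> block_namespace s c = None"
        using I(22) unfolding inv20_def by blast+
      \<comment> \<open>At \<open>w\<close> the frontier becomes \<open>q + 1\<close>, which may
        equal the block size: the block is then full but still open.\<close>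
      have "((write_ptr s)(w := snd (b, q) + 1)) (t', n') \<le> pages_per_block C"
        using K(4) q(2) by simp
      moreover have "((block_tenant s)(fst (b, q) := Some (fst w))) c = Some t' \<and>
           ((block_namespace s)(fst (b, q) := Some (snd w))) c = Some n' \<or>
         ((block_tenant s)(fst (b, q) := Some (fst w))) c = None \<and>
           ((block_namespace s)(fst (b, q) := Some (snd w))) c = None"
        using K(6) cb by (cases "c = b") auto
      ultimately show "c < total_blocks C \<and> \<not> free_block s c \<and> block_open s c \<and>
        ((write_ptr s)(w := snd (b, q) + 1)) (t', n') \<le> pages_per_block C \<and>
        (\<forall>w'. open_block s w' = Some c \<longrightarrow> w' = (t', n')) \<and>
        (((block_tenant s)(fst (b, q) := Some (fst w))) c = Some t' \<and>
           ((block_namespace s)(fst (b, q) := Some (snd w))) c = Some n' \<or>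
         ((block_tenant s)(fst (b, q) := Some (fst w))) c = None \<and>
           ((block_namespace s)(fst (b, q) := Some (snd w))) c = None)"
        using K by blast
    qed
    \<comment> \<open>In \<open>b\<close>, offsets from \<open>q + 1\<close> on were already at or
      past the old frontier \<open>q\<close>, and the written page is not among them.\<close>
    show "inv21 C ?s"
      using I(23) q B(4) unfolding inv21_def er nm store_simps
      by (metis Suc_eq_plus1 Suc_leD fun_upd_apply not_less_eq_eq order_refl prod.inject snd_conv)
    show "inv22 ?s" using I(24) by (auto simp: inv22_def lv)
    show "inv23 ?s" using I(25) by (simp add: inv23_def)
    show "inv24 ?s" using I(26) by (simp add: inv24_def)
    \<comment> \<open>The offsets below \<open>q + 1\<close> in \<open>b\<close> are those below
      \<open>q\<close> and the page just written.\<close>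
    show "inv25 C ?s"
      using I(27) q op unfolding inv25_def er by (auto simp: less_Suc_eq)
    show "inv26 ?s" using I(28) x(3,4) by (auto simp: inv26_def lab) (auto simp: labelled_def)
  qed
qed

text \<open>Serves both writes and relocations: each invalidates \<open>x\<close> first, so
  \<open>x\<close> is unmapped here. The destination is unmapped already in \<open>s\<close>, since
  \<open>destination\<close> leaves the map alone; hence storing there overwrites no other logical
  page.\<close>

lemma place_preserves:
  assumes inv: "ftl_invariant C s" and pl: "place C s x d g = Some s'"
    and x: "lpage_ok C x" "l2p_map s x = None" and g: "g \<noteq> None"
  shows ftl_invariant_place: "ftl_invariant C s'"
    and refines_place: "refines h s \<Longrightarrow> refines (h(x := Some d)) s'"
    and place_reclaimable: "reclaimable C s v \<Longrightarrow> reclaimable C s' v"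
    and place_other_block: "reclaimable C s v \<Longrightarrow> page_state s' (v, r) = page_state s (v, r)"
proof -
  from pl obtain t n s1 y where *: "addr_tenant s (fst x) = Some t"
    "addr_namespace s (fst x) = Some n"
    and dest: "destination C s (t, n) = Some (s1, y)" and s': "s' = store s1 (t, n) y x d g"
    by (rule placeD)
  obtain b q where y: "y = (b, q)" by fastforce
  have pos: "0 < pages_per_block C" using ftl_invariantD(1)[OF inv] by (simp add: wf0_def)
  note D = destination_frontier[OF pos dest[unfolded y]]
  note fr = destination_frame[OF dest]
  have inv1: "ftl_invariant C s1" by (rule ftl_invariant_destination[OF inv dest])
  show "ftl_invariant C s'"
    unfolding s' y using inv1 D x * g fr by (intro ftl_invariant_store) auto
  have un: "l2p_map s z \<noteq> Some (b, q)" for z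
    using frontier_unmapped(3)[OF inv1 D(1)] D(2,3) fr(1) by metis
  show "refines (h(x := Some d)) s'" if "refines h s"
    using that un unfolding refines_def s' y by (simp add: fr) (metis prod.inject)
  show "reclaimable C s' v" "page_state s' (v, r) = page_state s (v, r)" if "reclaimable C s v"
    using destination_reclaimable[OF inv dest[unfolded y] that]
    by (auto simp: s' reclaimable_def y fr)
qed

section \<open>Relocating the live pages of a victim\<close>

text \<open>Invalidation makes the old copy stale and the new copy lands outside \<open>v\<close>.
  The last conclusion, that \<open>v\<close> gains no live page, keeps earlier progress intact when
  pages are treated in turn.\<close>

lemma relocate_page_preserves:
  assumes inv: "ftl_invariant C s" and reloc: "relocate_page C s (v, q) = Some s'"
    and v: "reclaimable C s v" and q: "q < pages_per_block C"
  shows "ftl_invariant C s'" and "refines h s \<Longrightarrow> refines h s'" and "reclaimable C s' v"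
    and "\<not> live s' (v, q)" and "\<And>r. live s' (v, r) \<Longrightarrow> live s (v, r)"
proof -
  have "ftl_invariant C s' \<and> (refines h s \<longrightarrow> refines h s') \<and> reclaimable C s' v
    \<and> \<not> live s' (v, q) \<and> (\<forall>r. live s' (v, r) \<longrightarrow> live s (v, r))"
  proof (cases "page_state s (v, q)")
    case (PS_Valid d)
    with reloc obtain x where rm: "pm_rmap (page_meta s (v, q)) = Some x"
      and pl: "place C (invalidate s x) x d (pm_tag (page_meta s (v, q))) = Some s'"
      by (auto simp: relocate_page_def split: option.splits)
    note I = ftl_invariantD[OF inv]
    have lv: "live s (v, q)" using PS_Valid by (simp add: live_def)
    have ok: "ppage_ok C (v, q)" using v q by (simp add: reclaimable_def ppage_ok_def)
    \<comment> \<open>By clause 4 the reverse mapping is a true entry of the map, so invalidating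
      \<open>x\<close> hits the very page being moved.\<close>
    have map: "l2p_map s x = Some (v, q)" using I(6) rm lv ok by (auto simp: inv4_def)
    have g: "pm_tag (page_meta s (v, q)) \<noteq> None" using I(11) lv ok by (auto simp: inv9_def)
    have v': "reclaimable C (invalidate s x) v" using v by (simp add: reclaimable_def)
    note P = place_preserves[OF ftl_invariant_invalidate[OF inv] pl
        mapped_pageD(1)[OF inv map] _ g]
    have "refines h s'" if "refines h s"
    proof -
      have "refines (h(x := Some d)) s'"
        using P(2)[OF _ refines_invalidate[OF inv that]] by simp
      \<comment> \<open>\<open>refines\<close> lets \<open>h\<close> be undefined at
        \<open>x\<close> although the page is live, so \<open>h\<close> is in general only a submap
        of \<open>h(x := Some d)\<close>; \<open>refines_mono\<close> closes this gap.\<close>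
      moreover have "h x = None \<or> h x = Some d"
        using that map PS_Valid unfolding refines_def
        by (cases x; cases "h x") fastforce+
      ultimately show ?thesis
        by (elim refines_mono[rotated]) (auto simp: map_le_def)
    qed
    then show ?thesis
      using P(1) P(3,4)[OF _ v'] by (auto simp: live_def invalidate_page_state[OF map])
  qed (use assms in \<open>auto simp: relocate_page_def live_def\<close>)
  then show "ftl_invariant C s'" "refines h s \<Longrightarrow> refines h s'" "reclaimable C s' v"
    "\<not> live s' (v, q)" "\<And>r. live s' (v, r) \<Longrightarrow> live s (v, r)"
    by blast+
qed

text \<open>A page that is dead after its own relocation stays dead, because relocating the
  remaining pages creates no live page in \<open>v\<close>.\<close>

lemma relocate_pages_preserves:
  assumes "ftl_invariant C s" and "relocate_pages C s (map (Pair v) qs) = Some s'"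
    and "reclaimable C s v" and "\<forall>q \<in> set qs. q < pages_per_block C"
  shows "ftl_invariant C s' \<and> (refines h s \<longrightarrow> refines h s') \<and> reclaimable C s' v
    \<and> (\<forall>q \<in> set qs. \<not> live s' (v, q)) \<and> (\<forall>r. live s' (v, r) \<longrightarrow> live s (v, r))"
  using assms
proof (induction qs arbitrary: s)
  case Nil
  then show ?case by simp
next
  case (Cons q qs)
  then obtain s1 where 1: "relocate_page C s (v, q) = Some s1"
    and 2: "relocate_pages C s1 (map (Pair v) qs) = Some s'"
    by (auto split: option.splits)
  have q: "q < pages_per_block C" using Cons.prems by simp
  note R = relocate_page_preserves[OF Cons.prems(1) 1 Cons.prems(3) q]
  show ?case using Cons.IH[OF R(1) 2 R(3)] Cons.prems(4) R(2,4,5) by auto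
qed

section \<open>Erasing and reclaiming a block\<close>

lemma erase_simps [simp]:
  "l2p_map (erase C s b) = l2p_map s"
  "page_state (erase C s b) y =
     (if fst y = b \<and> snd y < pages_per_block C then PS_Empty else page_state s y)"
  "page_role (erase C s b) y =
     (if fst y = b \<and> snd y < pages_per_block C then None else page_role s y)"
  "page_meta (erase C s b) y =
     (if fst y = b \<and> snd y < pages_per_block C
      then \<lparr>pm_tenant = None, pm_namespace = None, pm_tag = None, pm_rmap = None\<rparr>
      else page_meta s y)"
  "addr_tenant (erase C s b) = addr_tenant s"
  "addr_namespace (erase C s b) = addr_namespace s"
  "block_tenant (erase C s b) = (block_tenant s)(b := None)"
  "block_namespace (erase C s b) = (block_namespace s)(b := None)"
  "region_table (erase C s b) = region_table s"
  "free_block_list (erase C s b) = b # free_block_list s"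
  "free_block (erase C s b) = (free_block s)(b := True)"
  "open_block (erase C s b) = open_block s"
  "write_ptr (erase C s b) = write_ptr s"
  "block_open (erase C s b) = block_open s"
  by (simp_all add: erase_def Let_def)

text \<open>Mapped pages are live and in bounds, so offsets outside the block are excluded as
  well.\<close>

lemma unmapped_dead_block:
  assumes "ftl_invariant C s" and "\<forall>q < pages_per_block C. \<not> live s (v, q)"
  shows "l2p_map s x \<noteq> Some (v, q)"
  using mapped_pageD(2,3)[OF assms(1), of x] assms(2) by (auto simp: ppage_ok_def)

text \<open>Without live pages \<open>v\<close> is unmapped, so dropping its labels and metadata
  affects no entry of the map. Joining the free list gives \<open>v\<close> its place in clause 10,
  and clauses 20 and 25 are untouched because \<open>v\<close> is nobody's open block.\<close>

lemma ftl_invariant_erase: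
  assumes inv: "ftl_invariant C s" and v: "reclaimable C s v"
    and dead: "\<forall>q < pages_per_block C. \<not> live s (v, q)"
  shows "ftl_invariant C (erase C s v)"
proof -
  let ?s = "erase C s v"
  let ?in = "\<lambda>y. fst y = v \<and> snd y < pages_per_block C"
  note I = ftl_invariantD[OF inv]
  note un = unmapped_dead_block[OF inv dead]
  have V: "v < total_blocks C" "v \<notin> set (free_block_list s)" "\<not> block_open s v"
    using v by (auto simp: reclaimable_def)
  have vopen: "open_block s w \<noteq> Some v" for w
    using I(22) V(3) by (cases w) (auto simp: inv20_def)
  have lv: "live ?s y \<longleftrightarrow> live s y" for y using dead by (cases y) (auto simp: live_def)
  have lvin: "live s y \<Longrightarrow> \<not> ?in y" for y using dead by (cases y) auto
  have st: "stale ?s y \<longleftrightarrow> stale s y \<and> \<not> ?in y" for y by (auto simp: stale_def)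
  have er: "erased ?s y \<longleftrightarrow> erased s y \<or> ?in y" for y by (auto simp: erased_def)
  have nm: "no_meta ?s y \<longleftrightarrow> no_meta s y \<or> ?in y" for y by (auto simp: no_meta_def)
  have mp: "mapped ?s = mapped s" by (simp add: fun_eq_iff mapped_def)
  have iu: "in_use C ?s c \<longleftrightarrow> in_use C s c" for c by (simp add: in_use_def mp)
  have iuv: "\<not> in_use C s v" using un by (auto simp: in_use_def mapped_def)
  have hs: "holds_stale C ?s c \<longleftrightarrow> holds_stale C s c \<and> c \<noteq> v" for c
    by (auto simp: holds_stale_def st)
  have lab: "labelled ?s a = labelled s a" for a by (simp add: labelled_def)
  show ?thesis
    unfolding ftl_invariant_def
  proof (intro conjI wf1_trivial)
    show "wf0 C" by (fact I(1))
    show "inv0 C ?s" using I(2) by (simp add: inv0_def lv)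
    show "inv1 C ?s" using I(3) by (simp add: inv1_def)
    show "inv2 ?s" using I(4) by (simp add: inv2_def)
    show "inv3 C ?s" using I(5) lvin by (auto simp: inv3_def lv)
    show "inv4 C ?s" using I(6) by (auto simp: inv4_def lv)
    show "inv5 C ?s" using I(7) iuv by (auto simp: inv5_def iu)
    show "inv6 C ?s" using I(8) by (auto simp: inv6_def er nm)
    show "inv7 C ?s" using I(9) lvin by (auto simp: inv7_def lv)
    show "inv8 C ?s" using I(10) V by (simp add: inv8_def)
    show "inv9 C ?s" using I(11) lvin by (auto simp: inv9_def lv)
    show "inv10 C ?s" using I(12) by (auto simp: inv10_def iu hs)
    show "inv11 ?s" using I(13) V by (simp add: inv11_def)
    show "inv12 C ?s" using I(14) by (auto simp: inv12_def iu hs)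
    show "inv13 C ?s" using I(15) lvin by (auto simp: inv13_def lv)
    show "inv14 C ?s" using I(16) by (auto simp: inv14_def lv)
    show "inv15 C ?s" using I(17) by (auto simp: inv15_def er)
    show "inv16 C ?s" using I(18) by (auto simp: inv16_def er)
    show "inv17 ?s" using I(19) by (auto simp: inv17_def)
    show "inv18 C ?s" using I(20) un by (auto simp: inv18_def)
    show "inv19 C ?s" using I(21) by (simp add: inv19_def)
    show "inv20 C ?s" using I(22) vopen by (auto simp: inv20_def)
    show "inv21 C ?s" using I(23) by (auto simp: inv21_def er nm)
    show "inv22 ?s" using I(24) by (auto simp: inv22_def lv)
    show "inv23 ?s" using I(25) by (simp add: inv23_def)
    show "inv24 ?s" using I(26) by (auto simp: inv24_def)
    show "inv25 C ?s" using I(27) vopen by (auto simp: inv25_def er)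
    show "inv26 ?s" using I(28) by (auto simp: inv26_def lab)
  qed
qed

lemma reclaim_preserves:
  assumes inv: "ftl_invariant C s" and sel: "victim_selection C sel"
    and rec: "reclaim C sel s = Some s'"
  shows "ftl_invariant C s'" and "refines h s \<Longrightarrow> refines h s'"
proof -
  from rec obtain v s1 where v: "sel s = Some v"
    and 1: "relocate_pages C s (map (Pair v) [0..<pages_per_block C]) = Some s1"
    and s': "s' = erase C s1 v"
    by (auto simp: reclaim_def split: option.splits)
  have "reclaimable C s v"
    using sel v unfolding victim_selection_def by (metis option.simps(5))
  note R = relocate_pages_preserves[OF inv 1 this, where h = h, simplified]
  have dead: "\<forall>q < pages_per_block C. \<not> live s1 (v, q)" using R by auto
  show "ftl_invariant C s'" using ftl_invariant_erase R dead unfolding s' by blast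
  \<comment> \<open>Erasure changes page states only inside \<open>v\<close>, where no entry of the
    map points, so \<open>refines\<close> reads the same data as before.\<close>
  have un: "l2p_map s1 x \<noteq> Some (v, q)" for x q
    using unmapped_dead_block R dead by blast
  show "refines h s'" if "refines h s"
  proof -
    have "refines h s1" using R that by blast
    then show ?thesis using un unfolding refines_def s' by simp metis
  qed
qed

section \<open>Tag updates\<close>

text \<open>Clauses 3, 4 and 7 read other components of the metadata, and clause 9 wants some tag,
  whichever it is. This leaves clauses 6 and 21, on pages without metadata.\<close>

lemma ftl_invariant_set_tag:
  assumes "ftl_invariant C s"
  shows "ftl_invariant C (set_tag s x g)"
proof (cases "\<exists>y. l2p_map s x = Some y \<and> live s y")
  case False
  then have "set_tag s x g = s" by (auto simp: set_tag_def split: option.splits)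
  then show ?thesis using assms by simp
next
  case True
  then obtain y where map: "l2p_map s x = Some y" and "live s y" by blast
  define s' where "s' = set_tag s x g"
  have s': "s' = s\<lparr>page_meta := (page_meta s)(y := (page_meta s y)\<lparr>pm_tag := Some g\<rparr>)\<rparr>"
    using map \<open>live s y\<close> by (simp add: s'_def set_tag_def)
  note I = ftl_invariantD[OF assms]
  have pg: "live s' = live s" "stale s' = stale s" "erased s' = erased s"
    "mapped s' = mapped s" "in_use C s' = in_use C s" "holds_stale C s' = holds_stale C s"
    "labelled s' = labelled s"
    by (auto simp: fun_eq_iff page_defs mapped_def in_use_def holds_stale_def labelled_def s')
  \<comment> \<open>Those pages are also erased, hence different from the live page
    \<open>y\<close>.\<close>
  have nm: "no_meta s' z" if "no_meta s z" "erased s z" for z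
    using that \<open>live s y\<close> by (auto simp: page_defs s')
  show ?thesis
    unfolding ftl_invariant_def s'_def[symmetric]
  proof (intro conjI wf1_trivial)
    show "wf0 C" by (fact I(1))
    show "inv0 C s'" using I(2) by (simp add: inv0_def pg) (simp add: s')
    show "inv1 C s'" using I(3) by (simp add: inv1_def s')
    show "inv2 s'" using I(4) by (simp add: inv2_def s')
    show "inv3 C s'" using I(5) by (simp add: inv3_def pg) (simp add: s')
    show "inv4 C s'" using I(6) by (simp add: inv4_def pg) (simp add: s')
    show "inv5 C s'" using I(7) by (simp add: inv5_def pg) (simp add: s')
    show "inv6 C s'" using I(8) nm by (simp add: inv6_def pg) (simp add: s')
    show "inv7 C s'" using I(9) unfolding inv7_def pg by (auto simp: s')
    show "inv8 C s'" using I(10) by (simp add: inv8_def s')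
    show "inv9 C s'" using I(11) by (simp add: inv9_def pg) (simp add: s')
    show "inv10 C s'" using I(12) by (simp add: inv10_def pg) (simp add: s')
    show "inv11 s'" using I(13) by (simp add: inv11_def s')
    show "inv12 C s'" using I(14) by (simp add: inv12_def pg) (simp add: s')
    show "inv13 C s'" using I(15) by (simp add: inv13_def pg) (simp add: s')
    show "inv14 C s'" using I(16) by (simp add: inv14_def pg) (simp add: s')
    show "inv15 C s'" using I(17) by (simp add: inv15_def pg) (simp add: s')
    show "inv16 C s'" using I(18) by (simp add: inv16_def pg) (simp add: s')
    show "inv17 s'" using I(19) by (simp add: inv17_def s')
    show "inv18 C s'" using I(20) by (simp add: inv18_def s')
    show "inv19 C s'" using I(21) by (simp add: inv19_def s')
    show "inv20 C s'" using I(22) by (simp add: inv20_def s')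
    show "inv21 C s'" using I(23) nm unfolding inv21_def pg by (auto simp: s')
    show "inv22 s'" using I(24) by (simp add: inv22_def pg) (simp add: s')
    show "inv23 s'" using I(25) by (simp add: inv23_def s')
    show "inv24 s'" using I(26) by (simp add: inv24_def s')
    show "inv25 C s'" using I(27) unfolding inv25_def pg by (simp add: s')
    show "inv26 s'" using I(28) by (simp add: inv26_def pg) (simp add: s')
  qed
qed

lemma refines_set_tag: "refines h s \<Longrightarrow> refines h (set_tag s x g)"
  by (auto simp: refines_def set_tag_def split: option.split)

section \<open>Single operations and traces\<close>

lemma step_preserves:
  assumes C: "valid_config C" and inv: "ftl_invariant C s" and ref: "refines h s"
    and step: "step C s \<sigma> = Some s'"
  shows "refines (abs_step h \<sigma>) s' \<and> ftl_invariant C s'"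
proof (cases \<sigma>)
  case (COpWrite a p d)
  with step have ok: "lpage_ok C (a, p)"
    and pl: "place C (invalidate s (a, p)) (a, p) d (Some (tag_of C d)) = Some s'"
    by (auto simp: write_page_def split: if_splits)
  note P = place_preserves[OF ftl_invariant_invalidate[OF inv] pl ok]
  \<comment> \<open>Deleting \<open>(a, p)\<close> from \<open>h\<close> and then setting it to
    \<open>d\<close> equals setting it directly, so the effects of invalidation and placement
    compose to \<open>abs_step\<close>.\<close>
  show ?thesis
    using P(1) P(2)[OF _ _ refines_invalidate[OF inv ref]] COpWrite by simp
next
  case (COpInvalidate a p)
  then show ?thesis
    using step ftl_invariant_invalidate[OF inv] refines_invalidate[OF inv ref] by auto
next
  case COpGC
  then show ?thesis
    using step reclaim_preserves[OF inv] ref C by (auto simp: valid_config_def)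
next
  case COpWearLevel
  then show ?thesis
    using step reclaim_preserves[OF inv] ref C by (auto simp: valid_config_def)
qed (use step inv ref ftl_invariant_set_tag refines_set_tag in auto)

theorem theorem5p3:
  fixes C :: "('d, 'g, 'k) ftl_config"
    and h :: "lpage \<rightharpoonup> 'd"
    and s s' :: "('d, 'g, 'k) ftl_state"
    and ops :: "('d, 'g) op list"
  assumes "valid_config C"
    and "ftl_invariant C s"
    and "refines h s"
    and "exec C s ops = Some s'"
  shows "refines (abs_exec h ops) s' \<and> ftl_invariant C s'"
  using assms(2-4)
proof (induction ops arbitrary: h s)
  case Nil
  then show ?case by simp
next
  case (Cons \<sigma> ops)
  from Cons.prems(3) obtain s1 where "step C s \<sigma> = Some s1" and "exec C s1 ops = Some s'"
    by (auto split: option.splits)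
  then show ?case
    using step_preserves[OF assms(1) Cons.prems(1,2)] Cons.IH[of s1 "abs_step h \<sigma>"] by simp
qed

end
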